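(* The number of WDFAs with set of states $[n]$ and $m$ transitions labeled from the effective alphabet $[\sigma]$, for which $1<2<\dots<n$ is a Wheeler order, is $$|\mathcal D_{n,m,\sigma}|=\binom{m-\sigma}{n-\sigma-1}\sum_{j=0}^{\sigma}(-1)^j\binom{\sigma}{j}\binom{n(\sigma-j)}{m}.$$
   Context: For a positive integer $k$, $[k]=\{1,\dots,k\}$. A DFA is a triple $D=(Q,\Sigma,\delta)$ with $Q=[n]$, source state $1$, alphabet $\Sigma=[\sigma]$ ordered as integers, and partial transition function $\delta:Q\times\Sigma\to Q$ (not necessarily complete); $m$ is the number of pairs on which $\delta$ is defined. DFAs are assumed to satisfy: state $v$ has at least one incoming transition iff $v>1$; they need not be connected. The alphabet is effective if every letter of $[\sigma]$ labels some transition. A DFA is Wheeler with respect to $1<\dots<n$ if: (i) whenever $u'=\delta(u,a)$, $v'=\delta(v,a')$ and $a<a'$, then $u'<v'$; (ii) whenever $u'=\delta(u,a)\ne\delta(v,a)=v'$ and $u<v$, then $u'<v'$. $\mathcal D_{n,m,\sigma}$ denotes the set of all such WDFAs with states $[n]$, $m$ transitions and effective alphabet $[\sigma]$. Standing assumptions: $n-1\le m\le n\sigma$ and $\sigma\le n-1$. *)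

theory Defs
  imports Complex_Main
begin

record dfa =
  states :: "nat set"
  alphabet :: "nat set"
  delta :: "nat \<times> nat \<rightharpoonup> nat"

text \<open>The source state is always \<open>1\<close>, so it is not a component of the record. States
  need not be reachable from it, and \<open>delta\<close> need not be defined on all of
  \<open>states \<times> alphabet\<close>; requiring its domain to lie inside that set makes
  equality of records coincide with equality of automata.\<close>

definition is_dfa :: "nat \<Rightarrow> nat \<Rightarrow> dfa \<Rightarrow> bool" where
  "is_dfa n \<sigma> D \<longleftrightarrow>
     states D = {1..n} \<and> alphabet D = {1..\<sigma>} \<and>
     dom (delta D) \<subseteq> states D \<times> alphabet D \<and> ran (delta D) \<subseteq> states D \<and>
     (\<forall>v\<in>states D. (\<exists>u a. delta D (u, a) = Some v) \<longleftrightarrow> v > 1)"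

definition num_transitions :: "dfa \<Rightarrow> nat" where
  "num_transitions D = card (dom (delta D))"

definition effective_alphabet :: "dfa \<Rightarrow> bool" where
  "effective_alphabet D \<longleftrightarrow> (\<forall>a\<in>alphabet D. \<exists>u v. delta D (u, a) = Some v)"

definition wheeler :: "dfa \<Rightarrow> bool" where
  "wheeler D \<longleftrightarrow>
     (\<forall>u v u' v' a a'. delta D (u, a) = Some u' \<longrightarrow> delta D (v, a') = Some v' \<longrightarrow>
        a < a' \<longrightarrow> u' < v') \<and>
     (\<forall>u v u' v' a. delta D (u, a) = Some u' \<longrightarrow> delta D (v, a) = Some v' \<longrightarrow>
        u' \<noteq> v' \<longrightarrow> u < v \<longrightarrow> u' < v')"

definition WDFAs :: "nat \<Rightarrow> nat \<Rightarrow> nat \<Rightarrow> dfa set" where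
  "WDFAs n m \<sigma> =
     {D. is_dfa n \<sigma> D \<and> wheeler D \<and> num_transitions D = m \<and> effective_alphabet D}"

lemma finite_WDFAs: "finite (WDFAs n m \<sigma>)"
proof -
  let ?A = "{1..n} \<times> {1..\<sigma>}"
  let ?F = "\<Union>X\<in>Pow ?A. {f :: nat \<times> nat \<rightharpoonup> nat. dom f = X \<and> ran f \<subseteq> {1..n}}"
  have "finite ?F"
    by (intro finite_UN_I finite_set_of_finite_maps) (auto intro: finite_subset)
  then have "finite ((\<lambda>f. \<lparr>states = {1..n}, alphabet = {1..\<sigma>}, delta = f\<rparr>) ` ?F)"
    by (rule finite_imageI)
  moreover have "WDFAs n m \<sigma> \<subseteq> (\<lambda>f. \<lparr>states = {1..n}, alphabet = {1..\<sigma>}, delta = f\<rparr>) ` ?F"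
  proof
    fix D assume "D \<in> WDFAs n m \<sigma>"
    then have D: "states D = {1..n}" "alphabet D = {1..\<sigma>}"
      "dom (delta D) \<subseteq> ?A" "ran (delta D) \<subseteq> {1..n}"
      unfolding WDFAs_def is_dfa_def by auto
    then have "delta D \<in> ?F" by blast
    moreover have "D = \<lparr>states = {1..n}, alphabet = {1..\<sigma>}, delta = delta D\<rparr>"
      using D by (cases D) simp
    ultimately show "D \<in> (\<lambda>f. \<lparr>states = {1..n}, alphabet = {1..\<sigma>}, delta = f\<rparr>) ` ?F"
      by (intro image_eqI[where x = "delta D"])
  qed
  ultimately show ?thesis using finite_subset by blast
qed

end

theory Submission
  imports Defs "HOL-Library.Product_Lexorder"
begin

text \<open>
  Order the transitions of a Wheeler DFA by letter and then by origin. Reading off the targets in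
  this order gives a weakly increasing map onto \<open>{2..n}\<close> that increases strictly whenever the
  letter changes. For a given domain of \<open>m\<close> transitions, such a map is determined by the set of
  transitions at which a new target first appears: an arbitrary set of \<open>n - 1\<close> transitions
  containing the first transition of each of the \<open>\<sigma>\<close> letters. This accounts for the binomial
  factor. Inclusion-exclusion over the letters counts the domains on which every letter occurs.
\<close>

section \<open>Monotone surjections with prescribed strict increases\<close>

text \<open>Values start at \<open>2\<close> because the source has no incoming transition; with
  \<open>k = n - 1\<close> they are the remaining states. In the application \<open>F\<close> holds
  the first transition of each letter.\<close>

definition mono_surj_maps :: "'a::linorder set \<Rightarrow> 'a set \<Rightarrow> nat \<Rightarrow> ('a \<rightharpoonup> nat) set" where
  "mono_surj_maps X F k =
     {f. dom f = X \<and> ran f = {2..Suc k} \<and>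
         (\<forall>x\<in>X. \<forall>y\<in>X. x \<le> y \<longrightarrow> the (f x) \<le> the (f y)) \<and>
         (\<forall>x\<in>X. \<forall>y\<in>F. x < y \<longrightarrow> the (f x) < the (f y))}"

text \<open>For a monotone \<open>f\<close> these are the first points of the fibres. The least
  point of the domain qualifies vacuously.\<close>

definition jumps :: "('a::linorder \<rightharpoonup> nat) \<Rightarrow> 'a set" where
  "jumps f = {y\<in>dom f. \<forall>x\<in>dom f. x < y \<longrightarrow> the (f x) < the (f y)}"

text \<open>Intended inverse of \<open>jumps\<close>; \<open>Suc\<close> makes the first jump take
  the value \<open>2\<close>.\<close>

definition rank_map :: "'a::linorder set \<Rightarrow> 'a set \<Rightarrow> ('a \<rightharpoonup> nat)" where
  "rank_map X S = (\<lambda>x. if x \<in> X then Some (Suc (card {s\<in>S. s \<le> x})) else None)"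

lemma dom_rank_map [simp]: "dom (rank_map X S) = X"
  by (auto simp: rank_map_def dom_def)

section \<open>Ranks relative to a finite subset of a linear order\<close>

lemma card_below_mono:
  fixes S :: "'a::linorder set"
  assumes "finite S" "x \<le> y"
  shows "card {s\<in>S. s \<le> x} \<le> card {s\<in>S. s \<le> y}"
  using assms by (intro card_mono) auto

lemma card_below_strict_mono:
  fixes S :: "'a::linorder set"
  assumes "finite S" "y \<in> S" "x < y"
  shows "card {s\<in>S. s \<le> x} < card {s\<in>S. s \<le> y}"
proof (rule psubset_card_mono)
  show "finite {s\<in>S. s \<le> y}" using assms by simp
  have "y \<notin> {s\<in>S. s \<le> x}" "y \<in> {s\<in>S. s \<le> y}" using assms by auto
  moreover have "{s\<in>S. s \<le> x} \<subseteq> {s\<in>S. s \<le> y}" using assms by auto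
  ultimately show "{s\<in>S. s \<le> x} \<subset> {s\<in>S. s \<le> y}" by blast
qed

lemma card_below_image:
  fixes S :: "'a::linorder set"
  assumes "finite S"
  shows "(\<lambda>x. card {s\<in>S. s \<le> x}) ` S = {1..card S}"
proof (rule card_subset_eq)
  let ?r = "\<lambda>x. card {s\<in>S. s \<le> x}"
  show "finite {1..card S}" by simp
  show "?r ` S \<subseteq> {1..card S}"
  proof (rule image_subsetI)
    fix x assume "x \<in> S"
    then have "card {x} \<le> ?r x" using assms by (intro card_mono) auto
    moreover have "?r x \<le> card S" using assms by (intro card_mono) auto
    ultimately show "?r x \<in> {1..card S}" by simp
  qed
  have "inj_on ?r S"
  proof (rule inj_onI, rule ccontr)
    fix a b assume *: "a \<in> S" "b \<in> S" "?r a = ?r b" "a \<noteq> b"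
    then consider "a < b" | "b < a" by (meson linorder_neqE)
    then show False
      using card_below_strict_mono[OF assms, of b a] card_below_strict_mono[OF assms, of a b] *
      by cases simp_all
  qed
  then show "card (?r ` S) = card {1..card S}" by (simp add: card_image)
qed

text \<open>The rank rises at each element of \<open>S\<close> and is constant in between. Without
  \<open>low\<close>, the least point of \<open>X\<close> could lie outside \<open>S\<close> and
  still be a jump vacuously.\<close>

lemma jumps_rank_map:
  assumes "finite X" "S \<subseteq> X" and low: "\<forall>x\<in>X. \<exists>y\<in>S. y \<le> x"
  shows "jumps (rank_map X S) = S"
proof (intro equalityI subsetI)
  have fin: "finite S" using assms finite_subset by blast
  fix y
  show "y \<in> jumps (rank_map X S)" if "y \<in> S"
    using that assms card_below_strict_mono[OF fin]
    by (auto simp: jumps_def) (auto simp: rank_map_def)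
  show "y \<in> S" if y: "y \<in> jumps (rank_map X S)"
  proof (rule ccontr)
    assume "y \<notin> S"
    have yX: "y \<in> X" using y by (simp add: jumps_def)
    \<comment> \<open>No element of \<open>S\<close> lies after \<open>s\<close> and up to
      \<open>y\<close>, so \<open>s\<close> and \<open>y\<close> have the same rank, which
      contradicts the strict increase at \<open>y\<close>.\<close>
    define s where "s = Max {s\<in>S. s \<le> y}"
    have ne: "{s\<in>S. s \<le> y} \<noteq> {}" using low yX by auto
    have s: "s \<in> S" "s \<le> y" using Max_in[OF _ ne] fin unfolding s_def by auto
    have max: "t \<le> s" if "t \<in> S" "t \<le> y" for t
      unfolding s_def using that fin by (intro Max_ge) auto
    have "s < y" using s \<open>y \<notin> S\<close> by (metis order_le_less)
    moreover have "{t\<in>S. t \<le> s} = {t\<in>S. t \<le> y}" using s max by auto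
    moreover have "s \<in> X" using s assms by auto
    ultimately show False using y yX by (auto simp: jumps_def) (auto simp: rank_map_def)
  qed
qed

text \<open>By \<open>low\<close> each rank is at least 1, so no value falls below \<open>2\<close>.
  Ranks of elements of \<open>S\<close> exhaust \<open>{1..card S}\<close>, and a rank increases
  strictly on reaching an element of \<open>S\<close>, hence of \<open>F\<close>.\<close>

lemma rank_map_in_mono_surj_maps:
  assumes "finite X" "F \<subseteq> S" "S \<subseteq> X" and low: "\<forall>x\<in>X. \<exists>y\<in>F. y \<le> x"
  shows "rank_map X S \<in> mono_surj_maps X F (card S)"
proof -
  have fin: "finite S" using assms finite_subset by blast
  have "ran (rank_map X S) = {2..Suc (card S)}"
  proof (intro equalityI subsetI)
    fix v assume "v \<in> ran (rank_map X S)"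
    then obtain x where x: "x \<in> X" "v = Suc (card {s\<in>S. s \<le> x})"
      by (auto simp: rank_map_def ran_def split: if_splits)
    obtain y where "y \<in> F" "y \<le> x" using low x by auto
    then have "card {y} \<le> card {s\<in>S. s \<le> x}" using assms fin by (intro card_mono) auto
    moreover have "card {s\<in>S. s \<le> x} \<le> card S" using fin by (intro card_mono) auto
    ultimately show "v \<in> {2..Suc (card S)}" using x by simp
  next
    fix v assume v: "v \<in> {2..Suc (card S)}"
    then have "v - 1 \<in> {1..card S}" by auto
    then obtain s where "s \<in> S" "v - 1 = card {t\<in>S. t \<le> s}"
      using card_below_image[OF fin] by (metis (no_types, lifting) imageE)
    then have "rank_map X S s = Some v" using v assms by (auto simp: rank_map_def)
    then show "v \<in> ran (rank_map X S)" by (rule ranI)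
  qed
  then show ?thesis
    using assms card_below_mono[OF fin] card_below_strict_mono[OF fin]
    by (auto simp: mono_surj_maps_def) (auto simp: rank_map_def subset_eq)
qed

text \<open>Each value first appears at exactly one jump, and by monotonicity the values seen up to
  \<open>x\<close> are those up to \<open>the (f x)\<close>. The first claim recovers
  \<open>f\<close> from its jumps; the second gives the number of jumps.\<close>

lemma bij_betw_jumps:
  assumes fin: "finite (dom f)" and f: "f \<in> mono_surj_maps X F k"
  shows "x \<in> X \<Longrightarrow> bij_betw (\<lambda>y. the (f y)) {s\<in>jumps f. s \<le> x} {2..the (f x)}"
    and "bij_betw (\<lambda>y. the (f y)) (jumps f) {2..Suc k}"
proof -
  let ?g = "\<lambda>y. the (f y)"
  have dom: "dom f = X" and ran: "ran f = {2..Suc k}"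
    and mono: "\<And>x y. x \<in> X \<Longrightarrow> y \<in> X \<Longrightarrow> x \<le> y \<Longrightarrow> ?g x \<le> ?g y"
    using f by (auto simp: mono_surj_maps_def)
  have sub: "jumps f \<subseteq> X" by (auto simp: jumps_def dom)
  have val: "?g y \<in> {2..Suc k}" if "y \<in> X" for y
    using that dom ran by (metis domD option.sel ranI)
  have inj: "inj_on ?g (jumps f)"
  proof (rule inj_onI)
    fix a b assume "a \<in> jumps f" "b \<in> jumps f" "?g a = ?g b"
    then show "a = b" unfolding jumps_def
      by (metis (mono_tags, lifting) linorder_neqE mem_Collect_eq order_less_irrefl)
  qed
  have surj: "\<exists>y\<in>jumps f. ?g y = v" if v: "v \<in> {2..Suc k}" for v
  proof -
    let ?Y = "{y\<in>X. ?g y = v}"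
    have finY: "finite ?Y" using fin dom by simp
    have "v \<in> ran f" using v ran by simp
    then obtain y where "f y = Some v" by (auto simp: ran_def)
    then have ne: "?Y \<noteq> {}" using dom by force
    \<comment> \<open>The first point of the fibre of \<open>v\<close> is a jump: earlier points
      have values at most \<open>v\<close> by monotonicity, and different from \<open>v\<close> by
      minimality.\<close>
    define y where "y = Min ?Y"
    have y: "y \<in> X" "?g y = v" using Min_in[OF finY ne] by (auto simp: y_def)
    have "?g z < ?g y" if "z \<in> X" "z < y" for z
    proof -
      have "?g z \<noteq> v" using Min_le[OF finY, of z] that by (auto simp: y_def)
      then show ?thesis using mono[of z y] that y by (simp add: order_less_imp_le order_le_neq_trans)
    qed
    then have "y \<in> jumps f" using y by (simp add: jumps_def dom)
    then show ?thesis using y by blast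
  qed
  show "bij_betw ?g (jumps f) {2..Suc k}"
    unfolding bij_betw_def using inj surj val sub by (auto simp: image_iff) blast+
  show "bij_betw ?g {s\<in>jumps f. s \<le> x} {2..?g x}" if x: "x \<in> X"
    unfolding bij_betw_def
  proof
    show "inj_on ?g {s\<in>jumps f. s \<le> x}" using inj by (rule inj_on_subset) auto
    show "?g ` {s\<in>jumps f. s \<le> x} = {2..?g x}"
    proof (intro equalityI subsetI)
      fix v assume "v \<in> ?g ` {s\<in>jumps f. s \<le> x}"
      then show "v \<in> {2..?g x}" using val mono sub x by force
    next
      fix v assume v: "v \<in> {2..?g x}"
      then have "v \<in> {2..Suc k}" using val[OF x] by auto
      then obtain y where y: "y \<in> jumps f" "?g y = v" using surj by blast
      have "y \<le> x"
      proof (rule ccontr)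
        assume "\<not> y \<le> x"
        then have "?g x < ?g y" using y x dom by (auto simp: jumps_def)
        then show False using v y by auto
      qed
      then show "v \<in> ?g ` {s\<in>jumps f. s \<le> x}" using y by blast
    qed
  qed
qed

lemma rank_map_jumps:
  assumes "finite X" and f: "f \<in> mono_surj_maps X F k"
  shows "rank_map X (jumps f) = f"
proof
  fix x
  have dom: "dom f = X" and ran: "ran f = {2..Suc k}"
    using f by (auto simp: mono_surj_maps_def)
  show "rank_map X (jumps f) x = f x"
  proof (cases "x \<in> X")
    case True
    then obtain v where v: "f x = Some v" using dom by blast
    \<comment> \<open>This keeps \<open>v\<close> positive, so that \<open>Suc (card {2..v})\<close>
      really is \<open>v\<close>.\<close>
    then have "v \<in> {2..Suc k}" using ran by (metis ranI)
    moreover have "card {s\<in>jumps f. s \<le> x} = card {2..v}"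
      using bij_betw_same_card[OF bij_betw_jumps(1)[OF _ f True]] assms(1) dom v by simp
    ultimately show ?thesis using v True by (simp add: rank_map_def)
  next
    case False
    then show ?thesis using dom by (auto simp: rank_map_def)
  qed
qed

text \<open>Removing \<open>F\<close> leaves a free choice of \<open>k - card F\<close> elements of
  \<open>X - F\<close>. The bound on \<open>card F\<close> keeps this subtraction from being
  truncated.\<close>

lemma card_sets_between:
  assumes "finite X" "F \<subseteq> X" "card F \<le> k"
  shows "card {S. F \<subseteq> S \<and> S \<subseteq> X \<and> card S = k} = (card X - card F) choose (k - card F)"
proof -
  have finF: "finite F" using assms finite_subset by blast
  have "bij_betw (\<lambda>S. S - F) {S. F \<subseteq> S \<and> S \<subseteq> X \<and> card S = k}
          {T. T \<subseteq> X - F \<and> card T = k - card F}"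
  proof (rule bij_betw_byWitness[where f' = "\<lambda>T. T \<union> F"])
    show "(\<lambda>S. S - F) ` {S. F \<subseteq> S \<and> S \<subseteq> X \<and> card S = k}
        \<subseteq> {T. T \<subseteq> X - F \<and> card T = k - card F}"
      using finF by (auto simp: card_Diff_subset)
    have "card (T \<union> F) = k" if T: "T \<subseteq> X - F" "card T = k - card F" for T
    proof -
      have "finite T" using T assms by (meson finite_Diff finite_subset)
      moreover have "T \<inter> F = {}" using T by auto
      ultimately show ?thesis using T assms finF by (simp add: card_Un_disjoint)
    qed
    then show "(\<lambda>T. T \<union> F) ` {T. T \<subseteq> X - F \<and> card T = k - card F}
        \<subseteq> {S. F \<subseteq> S \<and> S \<subseteq> X \<and> card S = k}"
      using assms by auto
  qed auto
  then have "card {S. F \<subseteq> S \<and> S \<subseteq> X \<and> card S = k}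
      = card {T. T \<subseteq> X - F \<and> card T = k - card F}"
    by (rule bij_betw_same_card)
  also have "\<dots> = card (X - F) choose (k - card F)"
    using assms by (intro n_subsets) auto
  finally show ?thesis using assms finF by (simp add: card_Diff_subset)
qed

text \<open>\<open>jumps\<close> and \<open>rank_map X\<close> are mutually inverse between these
  maps and the \<open>k\<close>-element sets between \<open>F\<close> and \<open>X\<close>.\<close>

lemma card_mono_surj_maps:
  assumes "finite X" "F \<subseteq> X" and low: "\<forall>x\<in>X. \<exists>y\<in>F. y \<le> x" and "card F \<le> k"
  shows "card (mono_surj_maps X F k) = (card X - card F) choose (k - card F)"
proof -
  have "bij_betw jumps (mono_surj_maps X F k) {S. F \<subseteq> S \<and> S \<subseteq> X \<and> card S = k}"
  proof (rule bij_betw_byWitness[where f' = "rank_map X"])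
    show "\<forall>f\<in>mono_surj_maps X F k. rank_map X (jumps f) = f"
      using rank_map_jumps assms by blast
    show "\<forall>S\<in>{S. F \<subseteq> S \<and> S \<subseteq> X \<and> card S = k}. jumps (rank_map X S) = S"
    proof clarify
      fix S assume S: "F \<subseteq> S" "S \<subseteq> X"
      have "\<forall>x\<in>X. \<exists>y\<in>S. y \<le> x" using low S(1) by blast
      with assms(1) S(2) show "jumps (rank_map X S) = S" by (rule jumps_rank_map)
    qed
    show "rank_map X ` {S. F \<subseteq> S \<and> S \<subseteq> X \<and> card S = k} \<subseteq> mono_surj_maps X F k"
      using rank_map_in_mono_surj_maps[OF assms(1) _ _ low] by auto
    show "jumps ` mono_surj_maps X F k \<subseteq> {S. F \<subseteq> S \<and> S \<subseteq> X \<and> card S = k}"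
    proof (rule image_subsetI)
      fix f assume f: "f \<in> mono_surj_maps X F k"
      then have dom: "dom f = X" by (simp add: mono_surj_maps_def)
      have "card (jumps f) = k"
        using bij_betw_same_card[OF bij_betw_jumps(2)[OF _ f]] assms dom by simp
      \<comment> \<open>The strictness condition on \<open>F\<close> says exactly that its points
        are jumps.\<close>
      moreover have "F \<subseteq> jumps f" "jumps f \<subseteq> X"
        using f assms(2) by (auto simp: jumps_def mono_surj_maps_def)
      ultimately show "jumps f \<in> {S. F \<subseteq> S \<and> S \<subseteq> X \<and> card S = k}" by simp
    qed
  qed
  from bij_betw_same_card[OF this] show ?thesis
    using card_sets_between[OF assms(1,2,4)] by simp
qed

section \<open>Supports of transition functions\<close>

text \<open>Pairs are written letter first, so that the lexicographic order on products sorts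
  transitions by letter and then by origin. The condition on \<open>fst\<close> expresses
  effectiveness of the alphabet \<open>A\<close>.\<close>

definition full_supports :: "nat set \<Rightarrow> nat \<Rightarrow> nat \<Rightarrow> (nat \<times> nat) set set" where
  "full_supports A n m = {X. X \<subseteq> A \<times> {1..n} \<and> card X = m \<and> fst ` X = A}"

lemma finite_full_supports:
  assumes "finite A"
  shows "finite (full_supports A n m)"
proof (rule finite_subset)
  show "full_supports A n m \<subseteq> Pow (A \<times> {1..n})" unfolding full_supports_def by blast
  show "finite (Pow (A \<times> {1..n}))" using assms by simp
qed

text \<open>The \<open>m\<close>-element subsets of \<open>A \<times> {1..n}\<close> are classified
  by the set of letters that they use.\<close>

lemma sum_card_full_supports:
  assumes "finite A"
  shows "(\<Sum>B\<in>Pow A. card (full_supports B n m)) = (n * card A) choose m"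
proof -
  have "\<forall>B\<in>Pow A. finite (full_supports B n m)"
    using assms finite_full_supports finite_subset by (metis PowD)
  moreover have "\<forall>B\<in>Pow A. \<forall>C\<in>Pow A. B \<noteq> C \<longrightarrow> full_supports B n m \<inter> full_supports C n m = {}"
    by (auto simp: full_supports_def)
  ultimately have "(\<Sum>B\<in>Pow A. card (full_supports B n m)) = card (\<Union>B\<in>Pow A. full_supports B n m)"
    using assms by (intro card_UN_disjoint[symmetric]) auto
  also have "(\<Union>B\<in>Pow A. full_supports B n m) = {X. X \<subseteq> A \<times> {1..n} \<and> card X = m}"
  proof (intro equalityI subsetI)
    fix X assume X: "X \<in> {X. X \<subseteq> A \<times> {1..n} \<and> card X = m}"
    then have "X \<in> full_supports (fst ` X) n m" by (force simp: full_supports_def)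
    moreover have "fst ` X \<in> Pow A" using X by auto
    ultimately show "X \<in> (\<Union>B\<in>Pow A. full_supports B n m)" by blast
  qed (auto simp: full_supports_def)
  also have "card \<dots> = (n * card A) choose m"
    using assms by (simp add: n_subsets card_cartesian_product mult.commute)
  finally show ?thesis .
qed

lemma sum_Pow_card:
  fixes g :: "nat \<Rightarrow> int"
  assumes "finite A"
  shows "(\<Sum>B\<in>Pow A. g (card B)) = (\<Sum>k=0..card A. int (card A choose k) * g k)"
proof -
  have "(\<Sum>B\<in>Pow A. g (card B)) = (\<Sum>k=0..card A. \<Sum>B\<in>{B\<in>Pow A. card B = k}. g (card B))"
    using assms by (intro sum.group[symmetric]) (auto intro: card_mono)
  also have "\<dots> = (\<Sum>k=0..card A. int (card A choose k) * g k)"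
    using assms by (intro sum.cong) (auto simp: n_subsets)
  finally show ?thesis .
qed

text \<open>Moebius inversion over the subsets of \<open>A\<close>, applied to
  \<open>sum_card_full_supports\<close>; the terms depend only on the size of the subset and are
  grouped by it.\<close>

lemma card_full_supports:
  assumes "finite A"
  shows "int (card (full_supports A n m)) =
    (\<Sum>j=0..card A. (-1) ^ j * int (card A choose j) * int ((n * (card A - j)) choose m))"
proof -
  have "int (card (full_supports A n m)) =
      (\<Sum>B\<in>Pow A. (-1) ^ (card A - card B) * int ((n * card B) choose m))"
    using assms
    by (intro inclusion_exclusion_mobius[where f = "\<lambda>A. int (card (full_supports A n m))"])
      (simp_all flip: sum_card_full_supports)
  also have "\<dots> = (\<Sum>k=0..card A. int (card A choose k) *
      ((-1) ^ (card A - k) * int ((n * k) choose m)))"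
    by (rule sum_Pow_card[OF assms])
  also have "\<dots> = (\<Sum>j=0..card A. (-1) ^ j * int (card A choose j) *
      int ((n * (card A - j)) choose m))"
    \<comment> \<open>\<open>k\<close> is the number of letters allowed, \<open>j\<close> the number
      excluded.\<close>
    by (rule sum.reindex_bij_witness[where i = "\<lambda>j. card A - j" and j = "\<lambda>k. card A - k"])
      (auto simp: binomial_symmetric[symmetric])
  finally show ?thesis .
qed

section \<open>The first transition of each letter\<close>

definition leading :: "(nat \<times> nat) set \<Rightarrow> (nat \<times> nat) set" where
  "leading X = {p\<in>X. \<forall>q\<in>X. fst q = fst p \<longrightarrow> snd p \<le> snd q}"

lemma ex_leading:
  assumes "(a, u) \<in> X"
  obtains w where "(a, w) \<in> leading X" "w \<le> u"
proof
  let ?w = "LEAST w. (a, w) \<in> X"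
  have "(a, ?w) \<in> X" using assms by (rule LeastI)
  then show "(a, ?w) \<in> leading X" by (auto simp: leading_def intro: Least_le)
  show "?w \<le> u" using assms by (rule Least_le)
qed

lemma card_leading: "card (leading X) = card (fst ` X)"
proof -
  have "inj_on fst (leading X)"
    by (rule inj_onI) (auto simp: leading_def prod_eq_iff intro: antisym)
  moreover have "fst ` leading X = fst ` X"
  proof (intro equalityI subsetI)
    fix a assume "a \<in> fst ` X"
    then obtain u where "(a, u) \<in> X" by auto
    then obtain w where "(a, w) \<in> leading X" by (rule ex_leading)
    then show "a \<in> fst ` leading X" by force
  qed (auto simp: leading_def)
  ultimately show ?thesis using card_image by fastforce
qed

section \<open>Wheeler automata as monotone surjections\<close>

text \<open>The swap puts the letter first. Within a letter, condition (ii) is weak monotonicity.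
  Across letters, condition (i) asks for strict increase, and given monotonicity it is enough to ask
  for it at the first transition of each letter.\<close>

lemma wheeler_iff:
  fixes D :: dfa
  defines "f \<equiv> delta D \<circ> prod.swap"
  shows "wheeler D \<longleftrightarrow>
    (\<forall>x\<in>dom f. \<forall>y\<in>dom f. x \<le> y \<longrightarrow> the (f x) \<le> the (f y)) \<and>
    (\<forall>x\<in>dom f. \<forall>y\<in>leading (dom f). x < y \<longrightarrow> the (f x) < the (f y))"
    (is "_ \<longleftrightarrow> ?mono \<and> ?strict")
proof -
  have f: "f (a, u) = delta D (u, a)" for a u by (simp add: f_def)
  show ?thesis
  proof (intro iffI conjI ballI impI)
    assume W: "wheeler D"
    have 1: "u' < v'" if "f (a, u) = Some u'" "f (a', v) = Some v'" "a < a'" for a a' u v u' v'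
      using W that unfolding wheeler_def f by blast
    have 2: "u' \<le> v'" if "f (a, u) = Some u'" "f (a, v) = Some v'" "u \<le> v" for a u v u' v'
      using W that unfolding wheeler_def f
      by (metis le_eq_less_or_eq option.inject)
    fix x y :: "nat \<times> nat"
    obtain a u b v where xy: "x = (a, u)" "y = (b, v)" by (cases x, cases y)
    show "the (f x) \<le> the (f y)" if "x \<in> dom f" "y \<in> dom f" "x \<le> y"
    proof (cases "a < b")
      case True
      then show ?thesis using that 1 by (auto simp: xy intro: less_imp_le)
    next
      case False
      then have "a = b" "u \<le> v" using that by (auto simp: xy)
      then show ?thesis using that 2 by (auto simp: xy)
    qed
    show "the (f x) < the (f y)" if "x \<in> dom f" "y \<in> leading (dom f)" "x < y"
    proof -
      \<comment> \<open>With equal letters, \<open>x < y\<close> would give \<open>x\<close> the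
        smaller origin, although \<open>y\<close> is leading.\<close>
      have "a < b" using that by (force simp: xy leading_def)
      then show ?thesis using that 1 by (auto simp: xy leading_def)
    qed
  next
    assume "?mono \<and> ?strict"
    then have mono: "\<And>x y. x \<in> dom f \<Longrightarrow> y \<in> dom f \<Longrightarrow> x \<le> y \<Longrightarrow> the (f x) \<le> the (f y)"
      and strict: "\<And>x y. x \<in> dom f \<Longrightarrow> y \<in> leading (dom f) \<Longrightarrow> x < y \<Longrightarrow> the (f x) < the (f y)"
      by blast+
    have "u' < v'" if *: "f (a, u) = Some u'" "f (b, v) = Some v'" "a < b" for a b u v u' v'
    proof -
      have "(b, v) \<in> dom f" using * by auto
      then obtain w where w: "(b, w) \<in> leading (dom f)" "w \<le> v" by (rule ex_leading)
      \<comment> \<open>The strict increase happens on entering letter \<open>b\<close> at its first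
        origin \<open>w\<close>; monotonicity carries it on to \<open>v\<close>.\<close>
      have "the (f (a, u)) < the (f (b, w))" using * w by (intro strict) auto
      also have "\<dots> \<le> the (f (b, v))" using * w by (intro mono) (auto simp: leading_def)
      finally show ?thesis using * by simp
    qed
    moreover have "u' < v'"
      if "f (a, u) = Some u'" "f (a, v) = Some v'" "u' \<noteq> v'" "u < v" for a u v u' v'
      using mono[of "(a, u)" "(a, v)"] that by (simp add: domI)
    ultimately show "wheeler D" unfolding wheeler_def f[symmetric] by blast
  qed
qed

text \<open>The conditions are matched one by one: effectiveness becomes fullness of the support,
  the condition on incoming transitions fixes the range, and the Wheeler property is
  \<open>wheeler_iff\<close>.\<close>

lemma WDFAs_iff:
  fixes D :: dfa
  defines "f \<equiv> delta D \<circ> prod.swap"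
  assumes "1 \<le> n"
  shows "D \<in> WDFAs n m \<sigma> \<longleftrightarrow> states D = {1..n} \<and> alphabet D = {1..\<sigma>} \<and>
    dom f \<in> full_supports {1..\<sigma>} n m \<and> f \<in> mono_surj_maps (dom f) (leading (dom f)) (n - 1)"
proof -
  have dom_iff: "(a, u) \<in> dom f \<longleftrightarrow> (u, a) \<in> dom (delta D)" for a u
    by (simp add: f_def domIff)
  have "dom f = prod.swap ` dom (delta D)"
    using dom_iff by (force simp del: domIff)
  then have card: "card (dom f) = card (dom (delta D))"
    by (simp add: card_image)
  have ran: "ran f = ran (delta D)"
    by (force simp: f_def ran_def)
  have sub: "dom f \<subseteq> A \<times> S \<longleftrightarrow> dom (delta D) \<subseteq> S \<times> A" for A S
    unfolding subset_iff split_paired_All mem_Times_iff dom_iff by auto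
  \<comment> \<open>Effectiveness yields only one inclusion; the other comes from the assumed bound
    on the domain.\<close>
  have eff: "fst ` dom f = {1..\<sigma>} \<longleftrightarrow> (\<forall>a\<in>{1..\<sigma>}. \<exists>u v. delta D (u, a) = Some v)"
    if "dom (delta D) \<subseteq> {1..n} \<times> {1..\<sigma>}"
  proof -
    have "fst ` dom f \<subseteq> {1..\<sigma>}" using that unfolding sub[symmetric] by auto
    then have "fst ` dom f = {1..\<sigma>} \<longleftrightarrow> (\<forall>a\<in>{1..\<sigma>}. a \<in> fst ` dom f)" by blast
    moreover have "a \<in> fst ` dom f \<longleftrightarrow> (\<exists>u v. delta D (u, a) = Some v)" for a
    proof -
      have "a \<in> fst ` dom f \<longleftrightarrow> (\<exists>u. (a, u) \<in> dom f)" by force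
      then show ?thesis unfolding dom_iff by blast
    qed
    ultimately show ?thesis by simp
  qed
  have onto: "ran (delta D) \<subseteq> {1..n} \<and> (\<forall>v\<in>{1..n}. (\<exists>u a. delta D (u, a) = Some v) \<longleftrightarrow> v > 1)
      \<longleftrightarrow> ran f = {2..n}"
  proof -
    have "(\<exists>u a. delta D (u, a) = Some v) \<longleftrightarrow> v \<in> ran (delta D)" for v
      by (auto simp: ran_def)
    then have *: "(\<forall>v\<in>{1..n}. (\<exists>u a. delta D (u, a) = Some v) \<longleftrightarrow> v > 1) \<longleftrightarrow>
        (\<forall>v\<in>{1..n}. v \<in> ran (delta D) \<longleftrightarrow> v > 1)" by simp
    have "{2..n} = {v\<in>{1..n}. v > 1}" by auto
    then show ?thesis unfolding ran * by blast
  qed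
  have n: "Suc (n - 1) = n" using assms(2) by simp
  show ?thesis
  proof (cases "states D = {1..n} \<and> alphabet D = {1..\<sigma>}")
    case True
    then have st: "states D = {1..n}" and al: "alphabet D = {1..\<sigma>}" by auto
    show ?thesis
      unfolding WDFAs_def is_dfa_def num_transitions_def effective_alphabet_def
        full_supports_def mono_surj_maps_def mem_Collect_eq st al sub card n
        wheeler_iff[of D, folded f_def]
      using eff onto by argo
  next
    case False
    then show ?thesis by (auto simp: WDFAs_def is_dfa_def)
  qed
qed

text \<open>States and alphabet are fixed, so an automaton is determined by its transition function,
  and swapping the arguments is an involution.\<close>

lemma card_WDFAs:
  assumes "1 \<le> n"
  shows "card (WDFAs n m \<sigma>) =
    card (\<Union>X\<in>full_supports {1..\<sigma>} n m. mono_surj_maps X (leading X) (n - 1))"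
proof (rule bij_betw_same_card[of "\<lambda>D. delta D \<circ> prod.swap"],
    rule bij_betw_byWitness[where
      f' = "\<lambda>f. \<lparr>states = {1..n}, alphabet = {1..\<sigma>}, delta = f \<circ> prod.swap\<rparr>"])
  let ?D = "\<lambda>f. \<lparr>states = {1..n}, alphabet = {1..\<sigma>}, delta = f \<circ> prod.swap\<rparr>"
  let ?U = "\<Union>X\<in>full_supports {1..\<sigma>} n m. mono_surj_maps X (leading X) (n - 1)"
  have swap: "f \<circ> prod.swap \<circ> prod.swap = f" for f :: "nat \<times> nat \<rightharpoonup> nat"
    by (simp add: comp_assoc)
  show "\<forall>D\<in>WDFAs n m \<sigma>. ?D (delta D \<circ> prod.swap) = D"
    using assms by (auto simp: WDFAs_iff swap)
  show "\<forall>f\<in>?U. delta (?D f) \<circ> prod.swap = f"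
    by (simp add: swap)
  show "(\<lambda>D. delta D \<circ> prod.swap) ` WDFAs n m \<sigma> \<subseteq> ?U"
    using assms by (auto simp: WDFAs_iff)
  show "?D ` ?U \<subseteq> WDFAs n m \<sigma>"
  proof (rule image_subsetI)
    fix f assume "f \<in> ?U"
    then obtain X where "X \<in> full_supports {1..\<sigma>} n m" "f \<in> mono_surj_maps X (leading X) (n - 1)"
      by blast
    moreover from this have "dom f = X" by (simp add: mono_surj_maps_def)
    ultimately show "?D f \<in> WDFAs n m \<sigma>"
      using assms by (simp add: WDFAs_iff swap)
  qed
qed

section \<open>Assembling the count\<close>

lemma finite_mono_surj_maps:
  fixes X :: "'a::linorder set"
  assumes "finite X"
  shows "finite (mono_surj_maps X F k)"
proof (rule finite_subset)
  show "mono_surj_maps X F k \<subseteq> {f. dom f = X \<and> ran f \<subseteq> {2..Suc k}}"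
    unfolding mono_surj_maps_def by blast
  show "finite {f :: 'a \<rightharpoonup> nat. dom f = X \<and> ran f \<subseteq> {2..Suc k}}"
    using assms by (intro finite_set_of_finite_maps) auto
qed

theorem theorem19:
  fixes n m \<sigma> :: nat
  assumes "1 \<le> n" and "n - 1 \<le> m" and "m \<le> n * \<sigma>" and "\<sigma> \<le> n - 1"
  shows "int (card (WDFAs n m \<sigma>)) =
    int ((m - \<sigma>) choose (n - \<sigma> - 1)) *
    (\<Sum>j=0..\<sigma>. (-1) ^ j * int (\<sigma> choose j) * int ((n * (\<sigma> - j)) choose m))"
proof -
  let ?XS = "full_supports {1..\<sigma>} n m"
  let ?M = "\<lambda>X. mono_surj_maps X (leading X) (n - 1)"
  have fin: "finite X" if "X \<in> ?XS" for X
    using that finite_subset[of X "{1..\<sigma>} \<times> {1..n}"] by (simp add: full_supports_def)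
  \<comment> \<open>The number of maps is the same for every support, so the total count factors.
    Here \<open>\<sigma> \<le> n - 1\<close> supplies the bound \<open>card F \<le> k\<close> of
    \<open>card_mono_surj_maps\<close>.\<close>
  have cardM: "card (?M X) = (m - \<sigma>) choose (n - \<sigma> - 1)" if X: "X \<in> ?XS" for X
  proof -
    have "card (leading X) = \<sigma>" "card X = m"
      using X by (simp_all add: card_leading full_supports_def)
    moreover have "\<forall>x\<in>X. \<exists>y\<in>leading X. y \<le> x"
    proof
      fix x assume "x \<in> X"
      moreover obtain a u where "x = (a, u)" by (cases x)
      ultimately obtain w where "(a, w) \<in> leading X" "w \<le> u" using ex_leading by blast
      then show "\<exists>y\<in>leading X. y \<le> x"
        using \<open>x = (a, u)\<close> by (intro bexI[of _ "(a, w)"]) auto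
    qed
    moreover have "leading X \<subseteq> X" by (auto simp: leading_def)
    moreover have "n - 1 - \<sigma> = n - \<sigma> - 1" by simp
    ultimately show ?thesis
      using card_mono_surj_maps[OF fin[OF X], of "leading X" "n - 1"] assms(4) by metis
  qed
  \<comment> \<open>The union is disjoint because a map determines its support as its
    domain.\<close>
  have "card (WDFAs n m \<sigma>) = (\<Sum>X\<in>?XS. card (?M X))"
    unfolding card_WDFAs[OF assms(1)]
    by (intro card_UN_disjoint)
      (auto simp: finite_full_supports finite_mono_surj_maps fin, auto simp: mono_surj_maps_def)
  also have "\<dots> = card ?XS * ((m - \<sigma>) choose (n - \<sigma> - 1))"
    using cardM by simp
  finally show ?thesis
    using card_full_supports[of "{1..\<sigma>}" n m] by simp
qed

end
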